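(* Let $A$ be a connected simple graph on $[n]$ with $n>2$, $B$ its binding graph on $[n_1]$ ($n_1=n(n+1)/2$), $\hat B=(m_{ij})$ the stable graph of $B$, and $\Phi=(\phi_{ij})$ the graph with $\phi_{ij}=x_0$ if $i\ne j$ and $(i,j)$ is not a binding edge of $B$, and $\phi_{ij}=m_{ij}$ otherwise (i.e. on the diagonal and on binding edges). Let $x\in\mathrm{Var}$ be a variable not occurring in $\Phi$, and define $\Theta=(\theta_{ij})$ by $\theta_{ii}=\phi_{ii}$ for binding vertices $i\in\{n+1,\dots,n_1\}$, $\theta_{ij}=x$ if $(i,j)$ is a binding edge, and $\theta_{ij}=x_0$ otherwise. Then $\hat\Phi\approx\hat\Theta$ and $\mathrm{WL}(\Phi)\approx\mathrm{WL}(\Theta)$.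
   Context: Labels are independent commuting indeterminates $x_0,x_1,\dots$; $\mathrm{Var}=\{x_1,x_2,\dots\}$. A graph of order $N$ is a symmetric $N\times N$ matrix over $\{x_0\}\cup\mathrm{Var}$; $\dim$ is the number of distinct entries. A simple graph has all diagonal entries $x_0$ and at most two distinct entries. $G\approx H$ means $g_{ij}=g_{st}\iff h_{ij}=h_{st}$ for all $i,j,s,t$. An equivalent variable substitution replaces the entries of a matrix by variables of $\mathrm{Var}$, equal entries by equal variables, distinct by distinct. Stable graph $\hat G$ (SaS process): $G_1$ is $G$ with its diagonal entries replaced by an equivalent variable substitution with fresh variables not occurring off the diagonal; $G_{i+1}$ is obtained from $G_i^2$ (commutative polynomial ring) by an equivalent variable substitution; $\hat G:=G_t$ for the first $t$ with $\dim(G_t)=\dim(G_{t+1})$. WL process: $x\diamond y$ is a non-commutative formal product of indeterminates ($x\diamond y=x'\diamond y'$ iff $x=x',y=y'$); $X\diamond Y$ has $(i,j)$ entry the formal sum $\sum_k x_{ik}\diamond y_{kj}$; $X_1=G_1$, $X_{i+1}$ obtained from $X_i\diamond X_i$ by an equivalent variable substitution, $\mathrm{WL}(G):=X_t$ for the first $t$ with $\dim(X_t)=\dim(X_{t+1})$. The binding graph $B$ of a simple graph $A$ on $[n]$: the simple graph on $[n_1]$ whose subgraph induced on $[n]$ is $A$ and where each pair of distinct $u,v\in[n]$ has a unique vertex $p\in\{n+1,\dots,n_1\}$ adjacent exactly to $u$ and $v$; the edges $(u,p),(v,p)$ are binding edges; vertices of $[n]$ are basic, the others binding vertices. *)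

theory Defs
  imports "Jordan_Normal_Form.Matrix" "HOL-Library.Poly_Mapping" "HOL-Library.Multiset"
begin

text \<open>
  The label \<open>k\<close> stands for the indeterminate \<open>x\<^sub>k\<close>. Rows and columns are
  numbered from 0, so the vertex set \<open>[n]\<close> is \<open>{0..<n}\<close>.
\<close>

type_synonym label = nat
type_synonym graph = "label mat"

abbreviation x0 :: label where "x0 \<equiv> 0"

definition Var :: "label set" where "Var = {k. k \<noteq> x0}"

text \<open>Polynomials over the integers in the commuting indeterminates \<open>x\<^sub>0, x\<^sub>1, \<dots>\<close>:
  the inner mapping is a monomial (exponents), the outer one gives the coefficients.\<close>

type_synonym label_poly = "(label \<Rightarrow>\<^sub>0 nat) \<Rightarrow>\<^sub>0 int"

definition indet :: "label \<Rightarrow> label_poly" where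
  "indet k = Poly_Mapping.single (Poly_Mapping.single k 1) 1"

definition is_graph :: "nat \<Rightarrow> graph \<Rightarrow> bool" where
  "is_graph N G \<longleftrightarrow> G \<in> carrier_mat N N \<and> transpose_mat G = G"

definition dim_graph :: "'a mat \<Rightarrow> nat" where
  "dim_graph M = card (elements_mat M)"

definition simple_graph :: "nat \<Rightarrow> graph \<Rightarrow> bool" where
  "simple_graph N G \<longleftrightarrow>
     is_graph N G \<and> (\<forall>i<N. G $$ (i, i) = x0) \<and> dim_graph G \<le> 2"

definition adjacent :: "graph \<Rightarrow> nat \<Rightarrow> nat \<Rightarrow> bool" where
  "adjacent G i j \<longleftrightarrow> i < dim_row G \<and> j < dim_row G \<and> i \<noteq> j \<and> G $$ (i, j) \<noteq> x0"

definition connected_graph :: "graph \<Rightarrow> bool" where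
  "connected_graph G \<longleftrightarrow> (\<forall>i<dim_row G. \<forall>j<dim_row G. (adjacent G)\<^sup>*\<^sup>* i j)"

text \<open>The relation \<open>\<approx>\<close>. The entries of the two matrices may be of different kinds
  (labels, polynomials, formal sums).\<close>

definition mat_equiv :: "'a mat \<Rightarrow> 'b mat \<Rightarrow> bool" (infix "\<approx>\<^sub>g" 50) where
  "G \<approx>\<^sub>g H \<longleftrightarrow> dim_row G = dim_row H \<and> dim_col G = dim_col H \<and>
     (\<forall>i<dim_row G. \<forall>j<dim_col G. \<forall>s<dim_row G. \<forall>t<dim_col G.
        G $$ (i, j) = G $$ (s, t) \<longleftrightarrow> H $$ (i, j) = H $$ (s, t))"

text \<open>\<open>H\<close> is a result of an equivalent variable substitution applied to \<open>M\<close>. The choice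
  of the variables is free, hence this and the notions derived from it are relations.\<close>

definition var_subst :: "'a mat \<Rightarrow> graph \<Rightarrow> bool" where
  "var_subst M H \<longleftrightarrow> M \<approx>\<^sub>g H \<and> elements_mat H \<subseteq> Var"

text \<open>\<open>H\<close> is a possible first graph \<open>G\<^sub>1\<close> of the processes started at \<open>G\<close>.\<close>

definition diag_subst :: "graph \<Rightarrow> graph \<Rightarrow> bool" where
  "diag_subst G H \<longleftrightarrow>
     dim_row H = dim_row G \<and> dim_col H = dim_col G \<and>
     (\<forall>i<dim_row G. \<forall>j<dim_col G. i \<noteq> j \<longrightarrow> H $$ (i, j) = G $$ (i, j)) \<and>
     (\<forall>i<dim_row G. H $$ (i, i) \<in> Var) \<and>
     (\<forall>i<dim_row G. \<forall>j<dim_row G. G $$ (i, i) = G $$ (j, j) \<longleftrightarrow> H $$ (i, i) = H $$ (j, j)) \<and>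
     (\<forall>i<dim_row G. \<forall>s<dim_row G. \<forall>t<dim_col G. s \<noteq> t \<longrightarrow> H $$ (i, i) \<noteq> G $$ (s, t))"

definition square :: "graph \<Rightarrow> label_poly mat" where
  "square G = map_mat indet G * map_mat indet G"

text \<open>A formal product \<open>x \<diamond> y\<close> is the pair \<open>(x, y)\<close>, a formal sum of such products is
  a multiset of pairs.\<close>

definition diamond :: "graph \<Rightarrow> graph \<Rightarrow> (label \<times> label) multiset mat" (infixl "\<diamond>" 70) where
  "X \<diamond> Y = mat (dim_row X) (dim_col Y)
     (\<lambda>(i, j). \<Sum>k = 0..<dim_row Y. {# (X $$ (i, k), Y $$ (k, j)) #})"

text \<open>The sequences are numbered from 0: \<open>S i\<close> is \<open>G\<^bsub>i+1\<^esub>\<close>, resp. \<open>X\<^bsub>i+1\<^esub>\<close>.\<close>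

definition SaS_process :: "graph \<Rightarrow> (nat \<Rightarrow> graph) \<Rightarrow> bool" where
  "SaS_process G S \<longleftrightarrow> diag_subst G (S 0) \<and> (\<forall>i. var_subst (square (S i)) (S (Suc i)))"

definition WL_process :: "graph \<Rightarrow> (nat \<Rightarrow> graph) \<Rightarrow> bool" where
  "WL_process G S \<longleftrightarrow> diag_subst G (S 0) \<and> (\<forall>i. var_subst (S i \<diamond> S i) (S (Suc i)))"

definition first_stable :: "(nat \<Rightarrow> graph) \<Rightarrow> graph" where
  "first_stable S = S (LEAST t. dim_graph (S t) = dim_graph (S (Suc t)))"

definition stable_graph :: "graph \<Rightarrow> graph \<Rightarrow> bool" where
  "stable_graph G H \<longleftrightarrow> (\<exists>S. SaS_process G S \<and> H = first_stable S)"

definition WL_graph :: "graph \<Rightarrow> graph \<Rightarrow> bool" where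
  "WL_graph G H \<longleftrightarrow> (\<exists>S. WL_process G S \<and> H = first_stable S)"

text \<open>The numbering of the binding vertices \<open>n, \<dots>, n\<^sub>1 - 1\<close> is arbitrary, so this is
  a relation as well.\<close>

definition binding_graph :: "nat \<Rightarrow> nat \<Rightarrow> graph \<Rightarrow> graph \<Rightarrow> bool" where
  "binding_graph n n1 A B \<longleftrightarrow>
     simple_graph n1 B \<and>
     (\<forall>i<n. \<forall>j<n. B $$ (i, j) = A $$ (i, j)) \<and>
     (\<forall>u<n. \<forall>v<n. u \<noteq> v \<longrightarrow> (\<exists>!p. p \<in> {n..<n1} \<and> {w. adjacent B p w} = {u, v}))"

definition binding_edge :: "nat \<Rightarrow> graph \<Rightarrow> nat \<Rightarrow> nat \<Rightarrow> bool" where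
  "binding_edge n B i j \<longleftrightarrow> adjacent B i j \<and> (i < n \<and> n \<le> j \<or> j < n \<and> n \<le> i)"

text \<open>Suitable substitutions always exist, so the relations above are never empty.\<close>

lemma ex_var_subst: "\<exists>H. var_subst M H"
proof -
  have "elements_mat M = (\<lambda>(i, j). M $$ (i, j)) ` ({0..<dim_row M} \<times> {0..<dim_col M})"
    by (auto simp: elements_mat_def image_iff)
  hence "finite (elements_mat M)" by simp
  then obtain f :: "_ \<Rightarrow> nat" where f: "inj_on f (elements_mat M)"
    using finite_imp_inj_to_nat_seg by blast
  have "var_subst M (map_mat (Suc \<circ> f) M)"
    using f by (auto simp: var_subst_def mat_equiv_def Var_def elements_mat_def inj_on_def)
  thus ?thesis by blast
qed

lemma ex_diag_subst:
  assumes "G \<in> carrier_mat N N"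
  shows "\<exists>H. diag_subst G H"
proof -
  define F where "F = (\<lambda>(i, j). G $$ (i, j)) ` ({0..<N} \<times> {0..<N})"
  define m where "m = Suc (Max (insert 0 F))"
  have fin: "finite (insert 0 F)" unfolding F_def by simp
  have less: "G $$ (s, t) < m" if "s < N" "t < N" for s t
  proof -
    have "G $$ (s, t) \<in> insert 0 F" using that by (force simp: F_def)
    thus ?thesis using fin by (simp add: m_def less_Suc_eq_le del: Max_insert)
  qed
  have ne: "m + a \<noteq> G $$ (s, t)" if "s < N" "t < N" for a s t
    using less[OF that] by simp
  have "diag_subst G (mat N N (\<lambda>(i, j). if i = j then m + G $$ (i, j) else G $$ (i, j)))"
    using assms ne by (auto simp: diag_subst_def Var_def m_def)
  thus ?thesis by blast
qed

lemma ex_stable_graph: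
  assumes "G \<in> carrier_mat N N"
  shows "\<exists>H. stable_graph G H"
proof -
  obtain G1 where G1: "diag_subst G G1" using ex_diag_subst[OF assms] by blast
  define S where "S = rec_nat G1 (\<lambda>_ X. SOME H. var_subst (square X) H)"
  have "SaS_process G S"
    unfolding SaS_process_def S_def using G1 by (auto intro: someI_ex[OF ex_var_subst])
  thus ?thesis unfolding stable_graph_def by blast
qed

lemma ex_WL_graph:
  assumes "G \<in> carrier_mat N N"
  shows "\<exists>H. WL_graph G H"
proof -
  obtain G1 where G1: "diag_subst G G1" using ex_diag_subst[OF assms] by blast
  define S where "S = rec_nat G1 (\<lambda>_ X. SOME H. var_subst (X \<diamond> X) H)"
  have "WL_process G S"
    unfolding WL_process_def S_def using G1 by (auto intro: someI_ex[OF ex_var_subst])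
  thus ?thesis unfolding WL_graph_def by blast
qed

end

theory Submission
  imports Defs
begin

text \<open>Order matrices by how fine the partition of their positions by equal entries is. Both processes
  end in the coarsest partition that refines the initial one and is stable under their product, and
  stability under \<open>\<diamond>\<close> implies stability under squaring. So it suffices that the initial graph of
  \<open>\<Phi>\<close> refines that of \<open>\<Theta>\<close>, and that every stable refinement \<open>K\<close> of the initial
  graph of \<open>\<Theta>\<close> refines the initial graph of \<open>\<Phi>\<close>. The former holds because binding vertices
  have degree 2 and basic ones degree at least 3. For the latter, the colour of the binding vertex of
  \<open>{u, v}\<close> in the stable graph of \<open>B\<close> tells whether \<open>u\<close> and \<open>v\<close> are adjacent,
  so \<open>K\<close> refines the initial graph of \<open>B\<close>, hence the stable graph of \<open>B\<close>, hence
  \<open>\<Phi>\<close>.\<close>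

section \<open>Refinement of matrices\<close>

definition refines :: "'a mat \<Rightarrow> 'b mat \<Rightarrow> bool" where
  "refines P Q \<longleftrightarrow> dim_row P = dim_row Q \<and> dim_col P = dim_col Q \<and>
     (\<forall>i<dim_row P. \<forall>j<dim_col P. \<forall>s<dim_row P. \<forall>t<dim_col P.
        P $$ (i, j) = P $$ (s, t) \<longrightarrow> Q $$ (i, j) = Q $$ (s, t))"

lemma refines_dim:
  assumes "refines P Q"
  shows "dim_row Q = dim_row P" "dim_col Q = dim_col P"
  using assms unfolding refines_def by metis+

lemma refines_entry:
  assumes "refines P Q" "i < dim_row P" "j < dim_col P" "s < dim_row P" "t < dim_col P"
    and "P $$ (i, j) = P $$ (s, t)"
  shows "Q $$ (i, j) = Q $$ (s, t)"
  using assms unfolding refines_def by blast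

lemma refinesI:
  assumes "dim_row Q = dim_row P" "dim_col Q = dim_col P"
    and "\<And>i j s t. i < dim_row P \<Longrightarrow> j < dim_col P \<Longrightarrow> s < dim_row P \<Longrightarrow> t < dim_col P \<Longrightarrow>
           P $$ (i, j) = P $$ (s, t) \<Longrightarrow> Q $$ (i, j) = Q $$ (s, t)"
  shows "refines P Q"
  unfolding refines_def by (intro conjI allI impI assms(1)[symmetric] assms(2)[symmetric] assms(3))

lemma refines_trans:
  assumes "refines P Q" "refines Q R"
  shows "refines P R"
proof (rule refinesI)
  fix i j s t assume b: "i < dim_row P" "j < dim_col P" "s < dim_row P" "t < dim_col P"
    and "P $$ (i, j) = P $$ (s, t)"
  hence "Q $$ (i, j) = Q $$ (s, t)" by (rule refines_entry[OF assms(1)])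
  thus "R $$ (i, j) = R $$ (s, t)"
    using b by (intro refines_entry[OF assms(2)]) (simp_all only: refines_dim[OF assms(1)])
qed (simp_all only: refines_dim[OF assms(1)] refines_dim[OF assms(2)])

lemma refines_refl: "refines P P"
  by (rule refinesI) auto

lemma mat_equiv_iff_refines: "P \<approx>\<^sub>g Q \<longleftrightarrow> refines P Q \<and> refines Q P"
proof
  assume eq: "P \<approx>\<^sub>g Q"
  hence d: "dim_row Q = dim_row P" "dim_col Q = dim_col P"
    unfolding mat_equiv_def by metis+
  have "P $$ (i, j) = P $$ (s, t) \<longleftrightarrow> Q $$ (i, j) = Q $$ (s, t)"
    if "i < dim_row P" "j < dim_col P" "s < dim_row P" "t < dim_col P" for i j s t
    using eq that unfolding mat_equiv_def by blast
  thus "refines P Q \<and> refines Q P"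
    by (intro conjI refinesI) (auto simp: d)
next
  assume "refines P Q \<and> refines Q P"
  hence PQ: "refines P Q" and QP: "refines Q P" by blast+
  show "P \<approx>\<^sub>g Q"
    unfolding mat_equiv_def
  proof (intro conjI allI impI)
    fix i j s t assume b: "i < dim_row P" "j < dim_col P" "s < dim_row P" "t < dim_col P"
    show "P $$ (i, j) = P $$ (s, t) \<longleftrightarrow> Q $$ (i, j) = Q $$ (s, t)"
      using refines_entry[OF PQ b] refines_entry[OF QP, unfolded refines_dim[OF PQ], OF b] by blast
  qed (simp_all only: refines_dim[OF PQ])
qed

lemma refines_carrier_matI:
  assumes "P \<in> carrier_mat N N" "Q \<in> carrier_mat N N"
    and "\<And>i j s t. i < N \<Longrightarrow> j < N \<Longrightarrow> s < N \<Longrightarrow> t < N \<Longrightarrow>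
           P $$ (i, j) = P $$ (s, t) \<Longrightarrow> Q $$ (i, j) = Q $$ (s, t)"
  shows "refines P Q"
  by (rule refinesI) (use assms(1,2) in \<open>auto intro: assms(3)\<close>)

lemma refinesD:
  assumes "refines P Q" "P \<in> carrier_mat N N" "i < N" "j < N" "s < N" "t < N"
    and "P $$ (i, j) = P $$ (s, t)"
  shows "Q $$ (i, j) = Q $$ (s, t)"
  by (rule refines_entry[OF assms(1)]) (use assms(2-7) in auto)

lemma refines_carrier:
  assumes "refines P Q"
  shows "P \<in> carrier_mat N N \<longleftrightarrow> Q \<in> carrier_mat N N"
  by (simp only: carrier_mat_def mem_Collect_eq refines_dim[OF assms])

text \<open>Rewrites refinement as a relabelling \<open>f\<close>, the form in which multisets of
  labels can be pushed forward from the finer matrix to the coarser one.\<close>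

lemma refines_imp_map:
  assumes "refines P Q"
  obtains f where "\<And>i j. i < dim_row P \<Longrightarrow> j < dim_col P \<Longrightarrow> Q $$ (i, j) = f (P $$ (i, j))"
proof -
  define f where "f a = (SOME b. \<exists>i<dim_row P. \<exists>j<dim_col P. P $$ (i, j) = a \<and> Q $$ (i, j) = b)" for a
  have "Q $$ (i, j) = f (P $$ (i, j))" if "i < dim_row P" "j < dim_col P" for i j
  proof -
    have "\<exists>b. \<exists>s<dim_row P. \<exists>t<dim_col P. P $$ (s, t) = P $$ (i, j) \<and> Q $$ (s, t) = b"
      using that by blast
    hence "\<exists>s<dim_row P. \<exists>t<dim_col P. P $$ (s, t) = P $$ (i, j) \<and> Q $$ (s, t) = f (P $$ (i, j))"
      unfolding f_def by (rule someI_ex)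
    then obtain s t where "s < dim_row P" "t < dim_col P" "P $$ (s, t) = P $$ (i, j)"
      and st: "Q $$ (s, t) = f (P $$ (i, j))" by blast
    hence "Q $$ (s, t) = Q $$ (i, j)" using that by (intro refines_entry[OF assms])
    thus ?thesis using st by simp
  qed
  thus thesis using that by blast
qed

section \<open>Refinement and the number of labels\<close>

lemma elements_mat_eq_image:
  "elements_mat M = (\<lambda>(i, j). M $$ (i, j)) ` ({0..<dim_row M} \<times> {0..<dim_col M})"
  by (auto simp: elements_mat_def image_iff)

lemma finite_elements_mat: "finite (elements_mat M)"
  by (simp add: elements_mat_eq_image)

lemma refines_elements_mat:
  assumes "refines P Q"
  obtains f where "\<And>i j. i < dim_row P \<Longrightarrow> j < dim_col P \<Longrightarrow> Q $$ (i, j) = f (P $$ (i, j))"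
    and "elements_mat Q = f ` elements_mat P"
proof -
  obtain f where f: "\<And>i j. i < dim_row P \<Longrightarrow> j < dim_col P \<Longrightarrow> Q $$ (i, j) = f (P $$ (i, j))"
    using refines_imp_map[OF assms] by blast
  have "elements_mat Q = f ` elements_mat P"
    unfolding elements_mat_eq_image image_image refines_dim[OF assms]
    by (intro image_cong) (auto simp: f)
  with f show thesis using that by blast
qed

lemma dim_graph_mono: "refines P Q \<Longrightarrow> dim_graph Q \<le> dim_graph P"
  by (erule refines_elements_mat) (simp add: dim_graph_def card_image_le finite_elements_mat)

text \<open>The relabelling is onto between finite label sets of equal size, hence injective, so it
  can be undone.\<close>

lemma refines_sym_if_dim_eq:
  assumes "refines P Q" "dim_graph P = dim_graph Q"
  shows "refines Q P"
proof -
  obtain f where f: "\<And>i j. i < dim_row P \<Longrightarrow> j < dim_col P \<Longrightarrow> Q $$ (i, j) = f (P $$ (i, j))"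
    and im: "elements_mat Q = f ` elements_mat P"
    using refines_elements_mat[OF assms(1)] by blast
  have "inj_on f (elements_mat P)"
    using assms(2) im by (intro eq_card_imp_inj_on finite_elements_mat) (simp add: dim_graph_def)
  thus ?thesis
    by (intro refinesI) (auto simp: refines_dim[OF assms(1)] f elements_mat_def dest!: inj_onD)
qed

lemma dim_graph_le:
  assumes "P \<in> carrier_mat N N"
  shows "dim_graph P \<le> N * N"
proof -
  have "dim_graph P \<le> card ({0..<dim_row P} \<times> {0..<dim_col P})"
    unfolding dim_graph_def elements_mat_eq_image by (intro card_image_le) simp
  thus ?thesis using assms by simp
qed

section \<open>Matrices whose diagonal labels do not occur off the diagonal\<close>

definition diag_separated :: "'a mat \<Rightarrow> bool" where
  "diag_separated P \<longleftrightarrow> (\<forall>i<dim_row P. \<forall>s<dim_row P. \<forall>t<dim_col P.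
     P $$ (i, i) = P $$ (s, t) \<longrightarrow> s = t)"

lemma diag_separatedD:
  assumes "diag_separated P" "P \<in> carrier_mat N N" "i < N" "s < N" "t < N"
    and "P $$ (i, i) = P $$ (s, t)"
  shows "s = t"
  using assms by (auto simp: diag_separated_def)

lemma refines_diag_separated:
  assumes "refines P Q" "P \<in> carrier_mat N N" "diag_separated Q"
  shows "diag_separated P"
  unfolding diag_separated_def
proof (intro allI impI)
  fix i s t assume b: "i < dim_row P" "s < dim_row P" "t < dim_col P" and "P $$ (i, i) = P $$ (s, t)"
  hence "Q $$ (i, i) = Q $$ (s, t)"
    using assms(2) by (intro refines_entry[OF assms(1)]) auto
  thus "s = t" using assms(3) b refines_dim[OF assms(1)] by (simp add: diag_separated_def)
qed

lemma diag_subst_carrier: "diag_subst G H \<Longrightarrow> G \<in> carrier_mat N N \<Longrightarrow> H \<in> carrier_mat N N"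
  by (auto simp: diag_subst_def)

lemma diag_subst_offdiag:
  assumes "diag_subst G H" "G \<in> carrier_mat N N" "i < N" "j < N" "i \<noteq> j"
  shows "H $$ (i, j) = G $$ (i, j)"
  using assms by (auto simp: diag_subst_def)

lemma diag_subst_diag_iff:
  assumes "diag_subst G H" "G \<in> carrier_mat N N" "i < N" "j < N"
  shows "H $$ (i, i) = H $$ (j, j) \<longleftrightarrow> G $$ (i, i) = G $$ (j, j)"
  using assms by (auto simp: diag_subst_def)

lemma diag_subst_separated:
  assumes "diag_subst G H" "G \<in> carrier_mat N N"
  shows "diag_separated H"
proof -
  have "s = t" if "i < N" "s < N" "t < N" "H $$ (i, i) = H $$ (s, t)" for i s t
  proof (rule ccontr)
    assume "s \<noteq> t"
    moreover from this have "H $$ (s, t) = G $$ (s, t)"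
      using diag_subst_offdiag[OF assms] that by blast
    ultimately show False using assms that by (auto simp: diag_subst_def)
  qed
  thus ?thesis using diag_subst_carrier[OF assms] by (auto simp: diag_separated_def)
qed

text \<open>Separation of \<open>P\<close> keeps a diagonal position from sharing its label with an
  off-diagonal one, so the mixed comparisons never arise; in the other two, the labels of
  \<open>G\<close> decide.\<close>

lemma refines_diag_substI:
  assumes "diag_subst G H" "G \<in> carrier_mat N N" "P \<in> carrier_mat N N" "diag_separated P"
    and "\<And>i j. i < N \<Longrightarrow> j < N \<Longrightarrow> P $$ (i, i) = P $$ (j, j) \<Longrightarrow> G $$ (i, i) = G $$ (j, j)"
    and "\<And>i j s t. i < N \<Longrightarrow> j < N \<Longrightarrow> s < N \<Longrightarrow> t < N \<Longrightarrow> i \<noteq> j \<Longrightarrow> s \<noteq> t \<Longrightarrow>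
           P $$ (i, j) = P $$ (s, t) \<Longrightarrow> G $$ (i, j) = G $$ (s, t)"
  shows "refines P H"
proof (rule refines_carrier_matI[OF assms(3) diag_subst_carrier[OF assms(1,2)]])
  fix i j s t assume b: "i < N" "j < N" "s < N" "t < N" and eq: "P $$ (i, j) = P $$ (s, t)"
  have "i = j \<longleftrightarrow> s = t"
    using diag_separatedD[OF assms(4,3) b(1,3,4)] diag_separatedD[OF assms(4,3) b(3,1,2)] eq by auto
  then consider "i = j" "s = t" | "i \<noteq> j" "s \<noteq> t" by blast
  thus "H $$ (i, j) = H $$ (s, t)"
  proof cases
    case 1
    thus ?thesis
      using eq diag_subst_diag_iff[OF assms(1,2) b(1,3)] assms(5)[OF b(1,3)] by simp
  next
    case 2
    thus ?thesis
      using diag_subst_offdiag[OF assms(1,2) b(1,2)] diag_subst_offdiag[OF assms(1,2) b(3,4)]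
        assms(6)[OF b 2 eq] by simp
  qed
qed

section \<open>Squares and formal products\<close>

text \<open>Commutativity turns a product of two indeterminates into an unordered pair of labels.\<close>

definition pair_sums :: "graph \<Rightarrow> nat \<Rightarrow> nat \<Rightarrow> label set multiset" where
  "pair_sums P i j = image_mset (\<lambda>k. {P $$ (i, k), P $$ (k, j)}) (mset_set {0..<dim_row P})"

text \<open>Comparing exponents compares multisets of size two, and such a multiset is determined by
  its support, so plain sets suffice.\<close>

lemma single_add_single_eq_iff:
  fixes a b c d :: nat
  shows "Poly_Mapping.single a (1 :: nat) + Poly_Mapping.single b 1 =
         Poly_Mapping.single c 1 + Poly_Mapping.single d 1 \<longleftrightarrow> {a, b} = {c, d}"
proof
  assume eq: "Poly_Mapping.single a (1 :: nat) + Poly_Mapping.single b 1 =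
         Poly_Mapping.single c 1 + Poly_Mapping.single d 1"
  have "{#a, b#} = {#c, d#}"
  proof (rule multiset_eqI)
    fix k
    show "count {#a, b#} k = count {#c, d#} k"
      using arg_cong[OF eq, of "\<lambda>p. Poly_Mapping.lookup p k"]
      by (simp add: lookup_add lookup_single when_def eq_commute[of _ k] del: One_nat_def split: if_splits)
  qed
  from arg_cong[OF this, of set_mset] show "{a, b} = {c, d}" by simp
next
  assume "{a, b} = {c, d}"
  thus "Poly_Mapping.single a (1 :: nat) + Poly_Mapping.single b 1 =
        Poly_Mapping.single c 1 + Poly_Mapping.single d 1"
    by (auto simp: doubleton_eq_iff add.commute)
qed

text \<open>A coefficient counts the indices producing its monomial. Nothing cancels, so a sum of
  monomials carries the same information as their multiset.\<close>

lemma lookup_sum_single: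
  assumes "finite A"
  shows "Poly_Mapping.lookup (\<Sum>k\<in>A. Poly_Mapping.single (f k) (1 :: int)) m =
         int (count (image_mset f (mset_set A)) m)"
  using assms by (induction A rule: finite_induct) (auto simp: lookup_add lookup_single when_def)

lemma sum_single_eq_iff_mset:
  assumes "finite A" "finite B"
  shows "(\<Sum>k\<in>A. Poly_Mapping.single (f k) (1 :: int)) = (\<Sum>k\<in>B. Poly_Mapping.single (g k) 1) \<longleftrightarrow>
         image_mset f (mset_set A) = image_mset g (mset_set B)"
  unfolding poly_mapping_eq_iff fun_eq_iff multiset_eq_iff
    lookup_sum_single[OF assms(1)] lookup_sum_single[OF assms(2)] of_nat_eq_iff ..

text \<open>Equal multisets have equal images under \<open>h\<close>; the primed terms arise from
  the unprimed ones by this single map on both sides.\<close>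

lemma mset_map_transfer:
  assumes "image_mset f A = image_mset g B"
    and "\<And>a. a \<in># A \<Longrightarrow> f' a = h (f a)" "\<And>b. b \<in># B \<Longrightarrow> g' b = h (g b)"
  shows "image_mset f' A = image_mset g' B"
proof -
  have "image_mset f' A = image_mset h (image_mset f A)"
    using assms(2) by (simp add: image_mset.compositionality comp_def cong: image_mset_cong)
  also have "\<dots> = image_mset h (image_mset g B)"
    by (simp only: assms(1))
  also have "\<dots> = image_mset g' B"
    using assms(3) by (simp add: image_mset.compositionality comp_def cong: image_mset_cong)
  finally show ?thesis .
qed

lemma square_entry:
  assumes "P \<in> carrier_mat N N" "i < N" "j < N"
  shows "square P $$ (i, j) = (\<Sum>k\<in>{0..<N}. Poly_Mapping.single
    (Poly_Mapping.single (P $$ (i, k)) 1 + Poly_Mapping.single (P $$ (k, j)) 1) 1)"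
  using assms by (simp add: square_def scalar_prod_def indet_def mult_single)

lemma square_eq_iff:
  assumes "P \<in> carrier_mat N N" "i < N" "j < N" "s < N" "t < N"
  shows "square P $$ (i, j) = square P $$ (s, t) \<longleftrightarrow> pair_sums P i j = pair_sums P s t"
    (is "_ \<longleftrightarrow> ?R")
proof -
  define mono :: "nat \<Rightarrow> nat \<Rightarrow> nat \<Rightarrow>\<^sub>0 nat"
    where "mono a b = Poly_Mapping.single a 1 + Poly_Mapping.single b 1" for a b
  have N: "dim_row P = N" using assms(1) by simp
  have mono: "mono a b = mono c d \<longleftrightarrow> {a, b} = {c, d}" for a b c d
    unfolding mono_def by (rule single_add_single_eq_iff)
  have "square P $$ (i, j) = square P $$ (s, t) \<longleftrightarrow>
      image_mset (\<lambda>k. mono (P $$ (i, k)) (P $$ (k, j))) (mset_set {0..<N}) =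
      image_mset (\<lambda>k. mono (P $$ (s, k)) (P $$ (k, t))) (mset_set {0..<N})"
    using assms by (simp add: square_entry sum_single_eq_iff_mset mono_def)
  also have "\<dots> \<longleftrightarrow> ?R"
  proof
    \<comment> \<open>\<open>h\<close> reads off the indeterminates of a monomial, unambiguously by
      \<open>mono\<close>. The map for the converse direction is built in the same way.\<close>
    define h where "h m = (SOME e. \<exists>a b. m = mono a b \<and> e = {a, b})" for m
    have h: "h (mono a b) = {a, b}" for a b
      unfolding h_def by (rule some_equality) (auto simp: mono)
    assume "image_mset (\<lambda>k. mono (P $$ (i, k)) (P $$ (k, j))) (mset_set {0..<N}) =
      image_mset (\<lambda>k. mono (P $$ (s, k)) (P $$ (k, t))) (mset_set {0..<N})"
    thus ?R unfolding pair_sums_def N by (rule mset_map_transfer[where h = h]) (simp_all add: h)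
  next
    define h where "h e = (SOME m. \<exists>a b. e = {a, b} \<and> m = mono a b)" for e
    have h: "h {a, b} = mono a b" for a b
      unfolding h_def by (rule some_equality) (auto simp: mono)
    assume ?R
    thus "image_mset (\<lambda>k. mono (P $$ (i, k)) (P $$ (k, j))) (mset_set {0..<N}) =
      image_mset (\<lambda>k. mono (P $$ (s, k)) (P $$ (k, t))) (mset_set {0..<N})"
      unfolding pair_sums_def N by (rule mset_map_transfer[where h = h]) (simp_all add: h)
  qed
  finally show ?thesis .
qed

lemma diamond_entry:
  assumes "P \<in> carrier_mat N N" "i < N" "j < N"
  shows "(P \<diamond> P) $$ (i, j) = image_mset (\<lambda>k. (P $$ (i, k), P $$ (k, j))) (mset_set {0..<N})"
proof -
  have "(\<Sum>k\<in>A. {# f k #}) = image_mset f (mset_set A)" if "finite A" for A :: "nat set"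
    and f :: "nat \<Rightarrow> label \<times> label"
    using that by (induction A rule: finite_induct) auto
  thus ?thesis using assms by (simp add: diamond_def)
qed

lemma square_carrier: "P \<in> carrier_mat N N \<Longrightarrow> square P \<in> carrier_mat N N"
  by (simp add: square_def)

lemma diamond_carrier: "P \<in> carrier_mat N N \<Longrightarrow> P \<diamond> P \<in> carrier_mat N N"
  by (simp add: diamond_def)

lemma pair_sums_eqD:
  assumes "pair_sums P i j = pair_sums P s t" "P \<in> carrier_mat N N" "k < N"
  shows "\<exists>l<N. {P $$ (i, k), P $$ (k, j)} = {P $$ (s, l), P $$ (l, t)}"
proof -
  have "{P $$ (i, k), P $$ (k, j)} \<in># pair_sums P i j"
    using assms(2,3) by (auto simp: pair_sums_def)
  thus ?thesis using assms(2) unfolding assms(1) by (auto simp: pair_sums_def)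
qed

lemma square_mono:
  assumes P: "P \<in> carrier_mat N N" and "refines P Q"
  shows "refines (square P) (square Q)"
proof -
  have Q: "Q \<in> carrier_mat N N" using assms refines_carrier by blast
  obtain f where f: "\<And>i j. i < N \<Longrightarrow> j < N \<Longrightarrow> Q $$ (i, j) = f (P $$ (i, j))"
    using refines_imp_map[OF assms(2)] P by auto
  show ?thesis
  proof (rule refines_carrier_matI[OF square_carrier[OF P] square_carrier[OF Q]])
    fix i j s t assume b: "i < N" "j < N" "s < N" "t < N"
      and "square P $$ (i, j) = square P $$ (s, t)"
    hence "pair_sums P i j = pair_sums P s t" using square_eq_iff[OF P] by blast
    hence "pair_sums Q i j = pair_sums Q s t"
      unfolding pair_sums_def carrier_matD(1)[OF P] carrier_matD(1)[OF Q]
      by (rule mset_map_transfer[where h = "(`) f"]) (use b in \<open>auto simp: f\<close>)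
    thus "square Q $$ (i, j) = square Q $$ (s, t)" using square_eq_iff[OF Q b] by blast
  qed
qed

lemma diamond_mono:
  assumes P: "P \<in> carrier_mat N N" and "refines P Q"
  shows "refines (P \<diamond> P) (Q \<diamond> Q)"
proof -
  have Q: "Q \<in> carrier_mat N N" using assms refines_carrier by blast
  obtain f where f: "\<And>i j. i < N \<Longrightarrow> j < N \<Longrightarrow> Q $$ (i, j) = f (P $$ (i, j))"
    using refines_imp_map[OF assms(2)] P by auto
  show ?thesis
  proof (rule refines_carrier_matI[OF diamond_carrier[OF P] diamond_carrier[OF Q]])
    fix i j s t assume b: "i < N" "j < N" "s < N" "t < N"
      and "(P \<diamond> P) $$ (i, j) = (P \<diamond> P) $$ (s, t)"
    from this(5) show "(Q \<diamond> Q) $$ (i, j) = (Q \<diamond> Q) $$ (s, t)"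
      unfolding diamond_entry[OF P b(1,2)] diamond_entry[OF P b(3,4)]
        diamond_entry[OF Q b(1,2)] diamond_entry[OF Q b(3,4)]
      by (rule mset_map_transfer[where h = "map_prod f f"]) (use b in \<open>auto simp: f\<close>)
  qed
qed

lemma diamond_refines_square:
  assumes P: "P \<in> carrier_mat N N"
  shows "refines (P \<diamond> P) (square P)"
proof (rule refines_carrier_matI[OF diamond_carrier[OF P] square_carrier[OF P]])
  fix i j s t assume b: "i < N" "j < N" "s < N" "t < N"
      and "(P \<diamond> P) $$ (i, j) = (P \<diamond> P) $$ (s, t)"
  from this(5) have "pair_sums P i j = pair_sums P s t"
    unfolding pair_sums_def carrier_matD(1)[OF P] diamond_entry[OF P b(1,2)] diamond_entry[OF P b(3,4)]
    by (rule mset_map_transfer[where h = "\<lambda>(a, b). {a, b}"]) simp_all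
  thus "square P $$ (i, j) = square P $$ (s, t)" using square_eq_iff[OF P b] by blast
qed

text \<open>Diagonal labels occur in an entry only through the terms \<open>k = i\<close> and \<open>k = j\<close>,
  so the old label can be read off.\<close>

lemma square_refines:
  assumes P: "P \<in> carrier_mat N N" and sep: "diag_separated P"
  shows "refines (square P) P"
proof (rule refines_carrier_matI[OF square_carrier[OF P] P])
  fix i j s t assume b: "i < N" "j < N" "s < N" "t < N"
      and "square P $$ (i, j) = square P $$ (s, t)"
  hence "pair_sums P i j = pair_sums P s t" using square_eq_iff[OF P] by blast
  from pair_sums_eqD[OF this P b(1)] obtain l
    where l: "l < N" "{P $$ (i, i), P $$ (i, j)} = {P $$ (s, l), P $$ (l, t)}" by blast
  have *: "P $$ (i, i) \<noteq> P $$ (a, b)" if "a < N" "b < N" "a \<noteq> b" for a b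
    using diag_separatedD[OF sep P b(1)] that by blast
  from l consider "P $$ (i, i) = P $$ (s, l)" "P $$ (i, j) = P $$ (l, t)"
    | "P $$ (i, i) = P $$ (l, t)" "P $$ (i, j) = P $$ (s, l)"
    by (auto simp: doubleton_eq_iff)
  thus "P $$ (i, j) = P $$ (s, t)" using * b l(1) by cases metis+
qed

section \<open>Stable partitions\<close>

text \<open>These properties are all that the analysis of a process uses, so one argument serves
  squaring and \<open>\<diamond>\<close> alike.\<close>

locale refinement_operator =
  fixes F :: "graph \<Rightarrow> 'c mat"
  assumes mono: "P \<in> carrier_mat N N \<Longrightarrow> refines P Q \<Longrightarrow> refines (F P) (F Q)"
    and refines_square: "P \<in> carrier_mat N N \<Longrightarrow> refines (F P) (square P)"
begin

lemma refining: "P \<in> carrier_mat N N \<Longrightarrow> diag_separated P \<Longrightarrow> refines (F P) P"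
  by (rule refines_trans[OF refines_square square_refines])

section \<open>Processes generated by one operator\<close>

context
  fixes G :: graph and S :: "nat \<Rightarrow> graph" and N :: nat
  assumes G: "G \<in> carrier_mat N N" and S0: "diag_subst G (S 0)"
    and SSuc: "\<And>i. var_subst (F (S i)) (S (Suc i))"
begin

lemma process_step: "refines (F (S i)) (S (Suc i))" "refines (S (Suc i)) (F (S i))"
  using SSuc[of i] by (auto simp: var_subst_def mat_equiv_iff_refines)

text \<open>Both parts are carried along together: \<open>refining\<close> needs separation, and
  separation is inherited by the finer matrix.\<close>

lemma process_invariant: "S i \<in> carrier_mat N N \<and> diag_separated (S i)"
proof (induction i)
  case 0
  show ?case using diag_subst_carrier[OF S0 G] diag_subst_separated[OF S0 G] by blast
next
  case (Suc i)
  hence r: "refines (S (Suc i)) (S i)"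
    using refines_trans[OF process_step(2) refining] by blast
  thus ?case using Suc refines_carrier refines_diag_separated by blast
qed

lemma process_refines_prev: "refines (S (Suc i)) (S i)"
  using refines_trans[OF process_step(2) refining] process_invariant by blast

lemma process_refines_initial: "refines (S i) (S 0)"
proof (induction i)
  case (Suc i)
  show ?case by (rule refines_trans[OF process_refines_prev Suc])
qed (rule refines_refl)

lemma process_stabilises: "\<exists>t. dim_graph (S t) = dim_graph (S (Suc t))"
proof (rule ccontr)
  assume "\<not> ?thesis"
  hence less: "dim_graph (S t) < dim_graph (S (Suc t))" for t
    using dim_graph_mono[OF process_refines_prev, of t] by (simp add: le_neq_implies_less)
  \<comment> \<open>Strict growth would push the number of labels beyond the \<open>N * N\<close>
    positions.\<close>
  have "t \<le> dim_graph (S t)" for t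
    by (induction t) (use less in \<open>auto simp: Suc_le_eq intro: le_less_trans\<close>)
  from this[of "Suc (N * N)"] show False
    using dim_graph_le[of "S (Suc (N * N))" N] process_invariant by fastforce
qed

text \<open>Equal dimensions upgrade the refinement between \<open>S (Suc t)\<close> and
  \<open>S t\<close> to an equivalence, and \<open>S (Suc t)\<close> induces the same partition as
  \<open>F (S t)\<close>.\<close>

lemma first_stable_stable: "refines (first_stable S) (F (first_stable S))"
proof -
  define t where "t = (LEAST t. dim_graph (S t) = dim_graph (S (Suc t)))"
  have "dim_graph (S t) = dim_graph (S (Suc t))"
    unfolding t_def using process_stabilises by (rule LeastI_ex)
  hence "refines (S t) (S (Suc t))"
    using refines_sym_if_dim_eq[OF process_refines_prev] by simp
  thus ?thesis
    unfolding first_stable_def t_def[symmetric] by (rule refines_trans[OF _ process_step(2)])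
qed

lemma first_stable_carrier: "first_stable S \<in> carrier_mat N N"
  by (simp add: first_stable_def process_invariant)

lemma first_stable_refines_initial: "refines (first_stable S) (S 0)"
  unfolding first_stable_def by (rule process_refines_initial)

lemma first_stable_separated: "diag_separated (first_stable S)"
  by (simp add: first_stable_def process_invariant)

lemma first_stable_refines_square: "refines (first_stable S) (square (first_stable S))"
  by (rule refines_trans[OF first_stable_stable refines_square[OF first_stable_carrier]])

text \<open>Induction along the process: if \<open>P\<close> is finer than \<open>S i\<close>, then
  by stability and monotonicity it is finer than \<open>F (S i)\<close>, hence than its relabelling
  \<open>S (Suc i)\<close>.\<close>

lemma refines_first_stable:
  assumes "refines P (S 0)" "refines P (F P)"
  shows "refines P (first_stable S)"
proof -
  have P: "P \<in> carrier_mat N N"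
    using refines_carrier[OF assms(1)] process_invariant by blast
  have "refines P (S i)" for i
  proof (induction i)
    case (Suc i)
    show ?case
      by (rule refines_trans[OF assms(2) refines_trans[OF mono[OF P Suc] process_step(1)]])
  qed (rule assms(1))
  thus ?thesis by (simp add: first_stable_def)
qed

text \<open>Keeps these labels apart from the filler \<open>x0\<close> of \<open>\<Phi>\<close> and
  \<open>\<Theta>\<close>. Every graph after the first has all its entries in
  \<open>Var\<close>.\<close>

lemma first_stable_label_Var:
  assumes "i < N" "j < N" "i = j \<or> G $$ (i, j) \<noteq> x0"
  shows "first_stable S $$ (i, j) \<in> Var"
proof -
  have "S t $$ (i, j) \<in> Var" for t
  proof (cases t)
    case 0
    show ?thesis
    proof (cases "i = j")
      case True
      thus ?thesis using 0 assms S0 G by (auto simp: diag_subst_def)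
    next
      case False
      thus ?thesis using 0 assms diag_subst_offdiag[OF S0 G] by (simp add: Var_def)
    qed
  next
    case (Suc t')
    have "S t $$ (i, j) \<in> elements_mat (S t)"
      using assms process_invariant[of t] by (blast intro: elements_matI)
    thus ?thesis using SSuc[of t'] Suc by (auto simp: var_subst_def)
  qed
  thus ?thesis by (simp add: first_stable_def)
qed

end

end

section \<open>The two instances, and walks of length two in stable matrices\<close>

interpretation SaS: refinement_operator square
  by unfold_locales (rule square_mono refines_refl; assumption)+

interpretation WL: refinement_operator "\<lambda>X. X \<diamond> X"
  by unfold_locales (rule diamond_mono diamond_refines_square; assumption)+

text \<open>The terms of a square are walks of length two. A stable label determines their multiset,
  the order of the two labels being lost to commutativity.\<close>

lemma square_stable_exchange:
  assumes "P \<in> carrier_mat N N" "refines P (square P)"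
    and "i < N" "j < N" "s < N" "t < N" "k < N" "P $$ (i, j) = P $$ (s, t)"
  shows "\<exists>l<N. {P $$ (i, k), P $$ (k, j)} = {P $$ (s, l), P $$ (l, t)}"
  using refinesD[OF assms(2,1,3-6,8)] square_eq_iff[OF assms(1,3-6)]
    pair_sums_eqD[OF _ assms(1,7)] by blast

text \<open>Take the walk through \<open>k = i\<close> or \<open>k = j\<close>: one of its labels is
  diagonal, and separation forces the matching walk through \<open>l = s\<close> or
  \<open>l = t\<close>. Commutativity may interchange the ends.\<close>

lemma square_stable_ends:
  assumes P: "P \<in> carrier_mat N N" "refines P (square P)" "diag_separated P"
    and b: "i < N" "j < N" "s < N" "t < N" and eq: "P $$ (i, j) = P $$ (s, t)"
  shows "P $$ (i, i) = P $$ (s, s) \<or> P $$ (i, i) = P $$ (t, t)"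
    and "P $$ (j, j) = P $$ (s, s) \<or> P $$ (j, j) = P $$ (t, t)"
proof -
  have *: "P $$ (k, k) = P $$ (s, s) \<or> P $$ (k, k) = P $$ (t, t)" if "k = i \<or> k = j" for k
  proof -
    have k: "k < N" using that b by blast
    from square_stable_exchange[OF P(1,2) b k eq] obtain l
      where l: "l < N" "{P $$ (i, k), P $$ (k, j)} = {P $$ (s, l), P $$ (l, t)}" by blast
    hence "P $$ (k, k) = P $$ (s, l) \<or> P $$ (k, k) = P $$ (l, t)" using that by auto
    thus ?thesis using diag_separatedD[OF P(3,1) k] b l(1) by metis
  qed
  thus "P $$ (i, i) = P $$ (s, s) \<or> P $$ (i, i) = P $$ (t, t)"
    and "P $$ (j, j) = P $$ (s, s) \<or> P $$ (j, j) = P $$ (t, t)" by blast+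
qed

section \<open>Binding graphs\<close>

locale binding_graph_of =
  fixes n n1 :: nat and A B :: graph
  assumes n: "n > 2" and A: "simple_graph n A" "connected_graph A"
    and n1: "n1 = n * (n + 1) div 2" and bind: "binding_graph n n1 A B"
begin

lemma B_carrier: "B \<in> carrier_mat n1 n1"
  using bind by (simp add: binding_graph_def simple_graph_def is_graph_def)

lemma B_sym: "i < n1 \<Longrightarrow> j < n1 \<Longrightarrow> B $$ (i, j) = B $$ (j, i)"
  using bind B_carrier unfolding binding_graph_def simple_graph_def is_graph_def
  by (metis carrier_matD index_transpose_mat(1))

lemma B_diag: "i < n1 \<Longrightarrow> B $$ (i, i) = x0"
  using bind by (simp add: binding_graph_def simple_graph_def)

lemma adjacent_iff: "adjacent B i j \<longleftrightarrow> i < n1 \<and> j < n1 \<and> i \<noteq> j \<and> B $$ (i, j) \<noteq> x0"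
  using B_carrier by (auto simp: adjacent_def)

lemma adjacent_sym: "adjacent B i j \<longleftrightarrow> adjacent B j i"
  using B_sym unfolding adjacent_iff by metis

lemma n_choose_2: "n choose 2 = n1 - n"
proof -
  have "n * (n + 1) = n * (n - 1) + 2 * n" using n by (cases n) auto
  thus ?thesis by (simp add: n1 choose_two)
qed

lemma n_le_n1: "n \<le> n1"
proof -
  have "n * 2 \<le> n * (n + 1)" using n by (intro mult_le_mono2) simp
  from div_le_mono[OF this, of 2] show ?thesis by (simp add: n1)
qed

lemma binding_vertex_exists:
  assumes "u < n" "v < n" "u \<noteq> v"
  obtains p where "n \<le> p" "p < n1" "{w. adjacent B p w} = {u, v}"
  using assms bind unfolding binding_graph_def by (metis atLeastLessThan_iff)

text \<open>There are as many binding vertices as pairs of basic vertices.\<close>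

lemma binding_vertex_neighbours:
  assumes "n \<le> p" "p < n1"
  obtains u v where "u < n" "v < n" "u \<noteq> v" "{w. adjacent B p w} = {u, v}"
proof -
  define E where "E = {e. e \<subseteq> {0..<n} \<and> card e = 2}"
  have "\<forall>e\<in>E. \<exists>p. p \<in> {n..<n1} \<and> {w. adjacent B p w} = e"
    unfolding E_def by (auto simp: card_2_iff intro: binding_vertex_exists)
  then obtain g where g: "\<And>e. e \<in> E \<Longrightarrow> g e \<in> {n..<n1} \<and> {w. adjacent B (g e) w} = e"
    by metis
  \<comment> \<open>A pair is recovered as the neighbourhood of the vertex that \<open>g\<close>
    chooses for it; by counting, \<open>g\<close> then reaches every vertex from \<open>n\<close>
    on.\<close>
  have "inj_on g E" by (rule inj_onI) (metis g)
  hence "card (g ` E) = card E" by (rule card_image)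
  also have "\<dots> = card {n..<n1}"
    unfolding E_def by (simp add: n_subsets n_choose_2)
  finally have "g ` E = {n..<n1}" using g by (intro card_subset_eq) auto
  then obtain e where "e \<in> E" "p = g e" using assms by (metis atLeastLessThan_iff imageE)
  thus thesis using g[of e] that unfolding E_def by (auto simp: card_2_iff)
qed

lemma binding_degree: "n \<le> p \<Longrightarrow> p < n1 \<Longrightarrow> card {w. adjacent B p w} = 2"
  by (elim binding_vertex_neighbours) auto

lemma finite_neighbours: "finite {w. adjacent B p w}"
  by (rule finite_subset[of _ "{..<n1}"]) (auto simp: adjacent_iff)

text \<open>Connectedness yields a basic neighbour \<open>v\<close>, and \<open>n > 2\<close> a
  third vertex \<open>w\<close>; the binding vertices of \<open>{u, v}\<close> and
  \<open>{u, w}\<close> are two further neighbours.\<close>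

lemma basic_degree:
  assumes "u < n"
  shows "card {w. adjacent B u w} \<ge> 3"
proof -
  have dA: "dim_row A = n" using A(1) by (auto simp: simple_graph_def is_graph_def)
  obtain a where "a < n" "a \<noteq> u"
    using n that[of 0] that[of 1] by (cases "u = 0") auto
  hence "(adjacent A)\<^sup>*\<^sup>* u a" using A(2) assms dA by (simp add: connected_graph_def)
  then obtain v where v: "adjacent A u v"
    using \<open>a \<noteq> u\<close> by (metis converse_rtranclpE)
  hence v': "v < n" "u \<noteq> v" "A $$ (u, v) \<noteq> x0" using dA by (auto simp: adjacent_def)
  have uv: "adjacent B u v"
    using v' assms n_le_n1 bind unfolding binding_graph_def adjacent_iff by auto
  obtain w where w: "w < n" "w \<noteq> u" "w \<noteq> v"
  proof -
    have "card {u, v} < card {0..<n}" using n v' by simp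
    then obtain w where "w \<in> {0..<n}" "w \<notin> {u, v}"
      by (metis card_mono finite.intros linorder_not_less subsetI)
    thus thesis using that by auto
  qed
  obtain p where p: "n \<le> p" "p < n1" "{w. adjacent B p w} = {u, v}"
    using binding_vertex_exists assms v' by metis
  obtain q where q: "n \<le> q" "q < n1" "{w. adjacent B q w} = {u, w}"
    using binding_vertex_exists assms w by metis
  have "{v, p, q} \<subseteq> {w. adjacent B u w}"
    using uv p q adjacent_sym by auto
  moreover have "card {v, p, q} = 3"
  proof -
    have "v \<noteq> p" "v \<noteq> q" using v' p q by auto
    moreover have "p \<noteq> q" using p(3) q(3) w by auto
    ultimately show ?thesis by simp
  qed
  ultimately show ?thesis using card_mono[OF finite_neighbours] by metis
qed

text \<open>The diagonal already uses \<open>x0\<close>, which leaves room for one further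
  label.\<close>

lemma edge_labels_eq:
  assumes "adjacent B i j" "adjacent B s t"
  shows "B $$ (i, j) = B $$ (s, t)"
proof (rule ccontr)
  assume ne: "B $$ (i, j) \<noteq> B $$ (s, t)"
  have b: "i < n1" "j < n1" "s < n1" "t < n1" using assms by (auto simp: adjacent_iff)
  have "B $$ (i, i) = x0" using b B_diag by blast
  moreover have "B $$ (i, i) \<in> elements_mat B" "B $$ (i, j) \<in> elements_mat B"
      "B $$ (s, t) \<in> elements_mat B"
    using b elements_matI[OF B_carrier _ _ refl] by blast+
  ultimately have "{x0, B $$ (i, j), B $$ (s, t)} \<subseteq> elements_mat B" by auto
  hence "card {x0, B $$ (i, j), B $$ (s, t)} \<le> dim_graph B"
    unfolding dim_graph_def by (intro card_mono finite_elements_mat)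
  moreover have "dim_graph B \<le> 2" using bind by (simp add: binding_graph_def simple_graph_def)
  ultimately show False using ne assms by (simp add: adjacent_iff)
qed

lemma binding_neighbour_basic:
  assumes "n \<le> p" "adjacent B p w"
  shows "w < n"
proof -
  have "p < n1" using assms(2) by (simp add: adjacent_iff)
  then obtain u v where uv: "u < n" "v < n" "{w. adjacent B p w} = {u, v}"
    using binding_vertex_neighbours assms(1) by metis
  have "w \<in> {w. adjacent B p w}" using assms(2) by simp
  thus ?thesis unfolding uv(3) using uv(1,2) by auto
qed

lemma binding_neighbours_eqI:
  assumes "n \<le> q" "adjacent B q s" "adjacent B q t" "s \<noteq> t"
  shows "{w. adjacent B q w} = {s, t}"
proof -
  have "q < n1" using assms(2) by (simp add: adjacent_iff)
  then obtain u v where "{w. adjacent B q w} = {u, v}"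
    using binding_vertex_neighbours assms(1) by metis
  moreover have "s \<in> {w. adjacent B q w}" "t \<in> {w. adjacent B q w}" using assms by simp_all
  ultimately show ?thesis using assms(4) by auto
qed

section \<open>Colours in the stable graph of \<open>B\<close>\<close>

context
  fixes M :: graph and S :: "nat \<Rightarrow> graph"
  assumes S: "SaS_process B S" and M: "M = first_stable S"
begin

lemma S_initial: "diag_subst B (S 0)" and S_step: "var_subst (square (S i)) (S (Suc i))"
  using S by (auto simp: SaS_process_def)

lemma M_carrier: "M \<in> carrier_mat n1 n1"
  and M_separated: "diag_separated M"
  and M_refines_initial: "refines M (S 0)"
  and M_stable: "refines M (square M)"
  and M_coarsest: "refines P (S 0) \<Longrightarrow> refines P (square P) \<Longrightarrow> refines P M"
  and M_Var: "i < n1 \<Longrightarrow> j < n1 \<Longrightarrow> i = j \<or> B $$ (i, j) \<noteq> x0 \<Longrightarrow> M $$ (i, j) \<in> Var"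
  unfolding M
  using SaS.first_stable_carrier[OF B_carrier S_initial S_step]
    SaS.first_stable_separated[OF B_carrier S_initial S_step]
    SaS.first_stable_refines_initial[OF B_carrier S_initial S_step]
    SaS.first_stable_stable[OF B_carrier S_initial S_step]
    SaS.refines_first_stable[OF B_carrier S_initial S_step]
    SaS.first_stable_label_Var[OF B_carrier S_initial S_step]
  by blast+

text \<open>Separation keeps \<open>(s, t)\<close> off the diagonal, and there \<open>S 0\<close>
  still has the labels of \<open>B\<close>.\<close>

lemma M_adjacent:
  assumes "i < n1" "j < n1" "s < n1" "t < n1" "M $$ (i, j) = M $$ (s, t)" "adjacent B i j"
  shows "adjacent B s t"
proof -
  have "s \<noteq> t"
    using diag_separatedD[OF M_separated M_carrier] assms by (metis adjacent_iff)
  moreover have "S 0 $$ (i, j) = S 0 $$ (s, t)"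
    using refinesD[OF M_refines_initial M_carrier] assms by blast
  ultimately show ?thesis
    using assms diag_subst_offdiag[OF S_initial B_carrier] by (auto simp: adjacent_iff)
qed

lemma M_adjacent_pair:
  assumes "{M $$ (a, b), M $$ (b, c)} = {M $$ (d, e), M $$ (e, f)}"
    and v: "a < n1" "b < n1" "c < n1" "d < n1" "e < n1" "f < n1"
    and adj: "adjacent B a b" "adjacent B b c"
  shows "adjacent B d e" "adjacent B e f"
proof -
  from assms(1) consider "M $$ (a, b) = M $$ (d, e)" "M $$ (b, c) = M $$ (e, f)"
    | "M $$ (a, b) = M $$ (e, f)" "M $$ (b, c) = M $$ (d, e)"
    unfolding doubleton_eq_iff by blast
  hence "adjacent B d e \<and> adjacent B e f"
    using M_adjacent[OF _ _ _ _ _ adj(1)] M_adjacent[OF _ _ _ _ _ adj(2)] v by cases blast+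
  thus "adjacent B d e" "adjacent B e f" by blast+
qed

text \<open>With \<open>c\<close> the common label of all edges, the degree is the number of terms
  \<open>{c}\<close> in the diagonal entry of the square of \<open>S 0\<close>; stability makes
  \<open>M\<close> finer than that square.\<close>

lemma M_diag_degree:
  assumes b: "i < n1" "j < n1" and eq: "M $$ (i, i) = M $$ (j, j)"
  shows "card {w. adjacent B i w} = card {w. adjacent B j w}"
proof -
  have S0: "S 0 \<in> carrier_mat n1 n1" using diag_subst_carrier[OF S_initial B_carrier] .
  \<comment> \<open>Any edge supplies \<open>c\<close>, and vertex 0 has one by its degree.
    Separation of \<open>S 0\<close> keeps \<open>c\<close> off the diagonal.\<close>
  obtain c where c: "\<And>s t. adjacent B s t \<Longrightarrow> B $$ (s, t) = c" "c \<noteq> x0"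
    and c_nd: "\<And>i. i < n1 \<Longrightarrow> S 0 $$ (i, i) \<noteq> c"
  proof -
    have "0 < n" using n by simp
    hence "{w. adjacent B 0 w} \<noteq> {}" using basic_degree[of 0] by fastforce
    then obtain w where w: "adjacent B 0 w" by blast
    hence "S 0 $$ (0, w) = B $$ (0, w)"
      using diag_subst_offdiag[OF S_initial B_carrier] by (simp add: adjacent_iff)
    hence "S 0 $$ (i, i) \<noteq> B $$ (0, w)" if "i < n1" for i
      using diag_separatedD[OF diag_subst_separated[OF S_initial B_carrier] S0 that] w
      by (metis adjacent_iff)
    thus thesis
      using that[of "B $$ (0, w)"] edge_labels_eq[OF _ w] w unfolding adjacent_iff by blast
  qed
  \<comment> \<open>A term \<open>{c}\<close> is a walk along an edge and back; the walk that stays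
    at \<open>i\<close> is excluded because \<open>c\<close> is no diagonal label.\<close>
  have adj: "{S 0 $$ (i, k), S 0 $$ (k, i)} = {c} \<longleftrightarrow> adjacent B i k" if "i < n1" "k < n1" for i k
  proof (cases "i = k")
    case True
    thus ?thesis using c_nd[OF that(1)] by (simp add: adjacent_iff)
  next
    case False
    thus ?thesis using that diag_subst_offdiag[OF S_initial B_carrier] B_sym c
      by (auto simp: adjacent_iff)
  qed
  have deg: "card {w. adjacent B i w} = size (filter_mset (\<lambda>e. e = {c}) (pair_sums (S 0) i i))"
    if "i < n1" for i
  proof -
    have "{w. adjacent B i w} = {k \<in> {0..<n1}. {S 0 $$ (i, k), S 0 $$ (k, i)} = {c}}"
      using adj[OF that] by (auto simp: adjacent_iff)
    thus ?thesis using S0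
      by (simp only: pair_sums_def filter_mset_image_mset size_image_mset)
        (simp add: filter_mset_mset_set)
  qed
  have "refines M (square (S 0))"
    using M_stable square_mono[OF M_carrier M_refines_initial] by (rule refines_trans)
  hence "square (S 0) $$ (i, i) = square (S 0) $$ (j, j)"
    using refinesD[OF _ M_carrier b(1) b(1) b(2) b(2) eq] by blast
  hence "pair_sums (S 0) i i = pair_sums (S 0) j j"
    using square_eq_iff[OF S0 b(1) b(1) b(2) b(2)] by blast
  thus ?thesis using deg b by simp
qed

lemma M_diag_basic:
  assumes "i < n1" "j < n1" "M $$ (i, i) = M $$ (j, j)"
  shows "i < n \<longleftrightarrow> j < n"
  using M_diag_degree[OF assms] basic_degree[of i] basic_degree[of j] binding_degree[of i]
    binding_degree[of j] assms(1,2) by (cases "i < n"; cases "j < n") auto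

text \<open>Adjacent \<open>u\<close> and \<open>v\<close> form a triangle with \<open>p\<close>.
  Stability copies the walk \<open>p, u, p\<close> to \<open>q, l, q\<close>, and then the walk
  \<open>p, v, u\<close> to one between \<open>q\<close> and \<open>l\<close> through some
  \<open>w\<close>, giving a triangle at \<open>q\<close>. Its other corners must be the only
  neighbours of \<open>q\<close>, namely \<open>s\<close> and \<open>t\<close>.\<close>

lemma M_binding_diag_adjacent:
  assumes p: "p < n1" "{w. adjacent B p w} = {u, v}" and q: "q < n1" "{w. adjacent B q w} = {s, t}"
    and eq: "M $$ (p, p) = M $$ (q, q)" and uv: "adjacent B u v"
  shows "adjacent B s t"
proof -
  have pu: "adjacent B p u" and pv: "adjacent B p v" using p(2) by blast+
  hence b: "u < n1" "v < n1" by (auto simp: adjacent_iff)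
  have N: "w = s \<or> w = t" if "adjacent B q w" for w using q(2) that by blast
  obtain l where l: "l < n1" "{M $$ (p, u), M $$ (u, p)} = {M $$ (q, l), M $$ (l, q)}"
    using square_stable_exchange[OF M_carrier M_stable p(1) p(1) q(1) q(1) b(1) eq] by blast
  then consider "M $$ (p, u) = M $$ (q, l)" | "M $$ (p, u) = M $$ (l, q)" by auto
  \<comment> \<open>Commutativity leaves the direction of the matching edge open, hence two
    cases.\<close>
  hence "\<exists>w. adjacent B q l \<and> adjacent B q w \<and> adjacent B w l"
  proof cases
    case 1
    obtain w where w: "w < n1" "{M $$ (p, v), M $$ (v, u)} = {M $$ (q, w), M $$ (w, l)}"
      using square_stable_exchange[OF M_carrier M_stable p(1) b(1) q(1) l(1) b(2) 1] by blast
    have "adjacent B q l" using M_adjacent[OF p(1) b(1) q(1) l(1) 1 pu] .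
    moreover have "adjacent B q w" "adjacent B w l"
      using M_adjacent_pair[OF w(2) p(1) b(2,1) q(1) w(1) l(1) pv] uv adjacent_sym by blast+
    ultimately show ?thesis by blast
  next
    case 2
    obtain w where w: "w < n1" "{M $$ (p, v), M $$ (v, u)} = {M $$ (l, w), M $$ (w, q)}"
      using square_stable_exchange[OF M_carrier M_stable p(1) b(1) l(1) q(1) b(2) 2] by blast
    have "adjacent B q l"
      using M_adjacent[OF p(1) b(1) l(1) q(1) 2 pu] adjacent_sym by blast
    moreover have "adjacent B l w" "adjacent B w q"
      using M_adjacent_pair[OF w(2) p(1) b(2,1) l(1) w(1) q(1) pv] uv adjacent_sym by blast+
    ultimately show ?thesis using adjacent_sym by blast
  qed
  then obtain w where "adjacent B q l" "adjacent B q w" "adjacent B w l" by blast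
  thus ?thesis using N adjacent_sym by (metis adjacent_iff)
qed

section \<open>Comparison of \<open>\<Phi>\<close> and \<open>\<Theta>\<close>\<close>

context
  fixes \<Phi> \<Theta> :: graph and x :: label
  assumes \<Phi>_def: "\<Phi> = mat n1 n1 (\<lambda>(i, j).
           if i \<noteq> j \<and> \<not> binding_edge n B i j then x0 else M $$ (i, j))"
    and x: "x \<in> Var"
    and \<Theta>_def: "\<Theta> = mat n1 n1 (\<lambda>(i, j).
           if i = j \<and> n \<le> i then \<Phi> $$ (i, i)
           else if binding_edge n B i j then x
           else x0)"
begin

lemma \<Phi>_carrier: "\<Phi> \<in> carrier_mat n1 n1" and \<Theta>_carrier: "\<Theta> \<in> carrier_mat n1 n1"
  by (simp_all add: \<Phi>_def \<Theta>_def)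

lemma \<Phi>_diag: "i < n1 \<Longrightarrow> \<Phi> $$ (i, i) = M $$ (i, i)"
  by (simp add: \<Phi>_def)

lemma \<Phi>_offdiag: "i < n1 \<Longrightarrow> j < n1 \<Longrightarrow> i \<noteq> j \<Longrightarrow>
    \<Phi> $$ (i, j) = (if binding_edge n B i j then M $$ (i, j) else x0)"
  by (simp add: \<Phi>_def)

lemma \<Theta>_diag: "i < n1 \<Longrightarrow> \<Theta> $$ (i, i) = (if n \<le> i then M $$ (i, i) else x0)"
  by (simp add: \<Theta>_def \<Phi>_diag binding_edge_def)

lemma \<Theta>_offdiag: "i < n1 \<Longrightarrow> j < n1 \<Longrightarrow> i \<noteq> j \<Longrightarrow>
    \<Theta> $$ (i, j) = (if binding_edge n B i j then x else x0)"
  by (simp add: \<Theta>_def)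

text \<open>Collapsing all basic colours to \<open>x0\<close> only merges classes, because
  \<open>M\<close> never gives a basic and a binding vertex the same colour; off the diagonal,
  \<open>\<Theta>\<close> records only which positions are binding edges.\<close>

lemma \<Phi>_refines_\<Theta>:
  assumes \<Phi>1: "diag_subst \<Phi> \<Phi>1" and \<Theta>1: "diag_subst \<Theta> \<Theta>1"
  shows "refines \<Phi>1 \<Theta>1"
proof (rule refines_diag_substI[OF \<Theta>1 \<Theta>_carrier diag_subst_carrier[OF \<Phi>1 \<Phi>_carrier]
      diag_subst_separated[OF \<Phi>1 \<Phi>_carrier]])
  fix i j assume b: "i < n1" "j < n1" "\<Phi>1 $$ (i, i) = \<Phi>1 $$ (j, j)"
  hence "M $$ (i, i) = M $$ (j, j)"
    using diag_subst_diag_iff[OF \<Phi>1 \<Phi>_carrier] \<Phi>_diag by simp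
  thus "\<Theta> $$ (i, i) = \<Theta> $$ (j, j)"
    using M_diag_basic[OF b(1,2)] b \<Theta>_diag by auto
next
  fix i j s t assume b: "i < n1" "j < n1" "s < n1" "t < n1" "i \<noteq> j" "s \<noteq> t"
    "\<Phi>1 $$ (i, j) = \<Phi>1 $$ (s, t)"
  hence "\<Phi> $$ (i, j) = \<Phi> $$ (s, t)"
    using diag_subst_offdiag[OF \<Phi>1 \<Phi>_carrier] by simp
  \<comment> \<open>Labels in \<open>Var\<close> tell binding edges from the positions filled with
    \<open>x0\<close>.\<close>
  moreover have "M $$ (i, j) \<noteq> x0" if "binding_edge n B i j" for i j
    using that M_Var[of i j] by (auto simp: binding_edge_def adjacent_iff Var_def)
  ultimately have "binding_edge n B i j \<longleftrightarrow> binding_edge n B s t"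
    unfolding \<Phi>_offdiag[OF b(1,2,5)] \<Phi>_offdiag[OF b(3,4,6)] by metis
  thus "\<Theta> $$ (i, j) = \<Theta> $$ (s, t)"
    using \<Theta>_offdiag[OF b(1,2,5)] \<Theta>_offdiag[OF b(3,4,6)] by simp
qed

text \<open>Assuming stability under squaring alone covers both processes. The way leads through
  \<open>S 0\<close> and \<open>M\<close>, once \<open>K\<close> is seen to recognise every edge of
  \<open>B\<close>.\<close>

lemma stable_\<Theta>_refines_\<Phi>:
  assumes \<Phi>1: "diag_subst \<Phi> \<Phi>1" and \<Theta>1: "diag_subst \<Theta> \<Theta>1"
    and K: "refines K \<Theta>1" "refines K (square K)"
  shows "refines K \<Phi>1"
proof -
  have Kc: "K \<in> carrier_mat n1 n1"
    using refines_carrier[OF K(1)] diag_subst_carrier[OF \<Theta>1 \<Theta>_carrier] by blast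
  have sep: "diag_separated K"
    using refines_diag_separated[OF K(1) Kc] diag_subst_separated[OF \<Theta>1 \<Theta>_carrier] by blast
  have K_diag: "K $$ (i, i) = K $$ (j, j) \<Longrightarrow> \<Theta> $$ (i, i) = \<Theta> $$ (j, j)" if "i < n1" "j < n1" for i j
    using refinesD[OF K(1) Kc] diag_subst_diag_iff[OF \<Theta>1 \<Theta>_carrier] that by blast
  \<comment> \<open>The diagonal of \<open>\<Theta>\<close> has \<open>x0\<close> exactly at the
    basic vertices, since colours of \<open>M\<close> on the diagonal lie in
    \<open>Var\<close>.\<close>
  have K_basic: "i < n \<longleftrightarrow> j < n" if "i < n1" "j < n1" "K $$ (i, i) = K $$ (j, j)" for i j
    using K_diag[OF that] \<Theta>_diag that M_Var[of i i] M_Var[of j j]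
    by (auto simp: Var_def not_less split: if_splits)
  have K_binding_edge: "binding_edge n B s t"
    if b: "i < n1" "j < n1" "s < n1" "t < n1" and eq: "K $$ (i, j) = K $$ (s, t)"
      and e: "binding_edge n B i j" for i j s t
  proof -
    have ij: "i \<noteq> j" using e by (simp add: binding_edge_def adjacent_iff)
    hence st: "s \<noteq> t" using diag_separatedD[OF sep Kc] b eq by metis
    have "\<Theta> $$ (i, j) = \<Theta> $$ (s, t)"
      using refinesD[OF K(1) Kc b eq] diag_subst_offdiag[OF \<Theta>1 \<Theta>_carrier] b ij st by simp
    thus ?thesis using \<Theta>_offdiag b ij st e x by (auto simp: Var_def split: if_splits)
  qed
  have K_adjacent: "adjacent B s t"
    if b: "i < n1" "j < n1" "s < n1" "t < n1" and eq: "K $$ (i, j) = K $$ (s, t)"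
      and adj: "adjacent B i j" for i j s t
  proof (cases "binding_edge n B i j")
    case True
    thus ?thesis using K_binding_edge[OF b eq] by (simp add: binding_edge_def)
  next
    case False
    hence ij: "i < n" "j < n"
      using adj binding_neighbour_basic adjacent_sym unfolding binding_edge_def
      by (metis not_less)+
    have "i \<noteq> j" using adj by (simp add: adjacent_iff)
    hence ne: "s \<noteq> t" using diag_separatedD[OF sep Kc] b eq by metis
    \<comment> \<open>Read from \<open>(s, t)\<close> to \<open>(i, j)\<close>: each of
      \<open>s\<close> and \<open>t\<close> has the colour of a basic vertex.\<close>
    note ends = square_stable_ends[OF Kc K(2) sep b(3,4,1,2) eq[symmetric]]
    have st: "s < n" "t < n" using ends K_basic b ij by metis+
    \<comment> \<open>The walk \<open>i, p, j\<close> consists of binding edges, so its match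
      \<open>s, q, t\<close> does too, which makes \<open>q\<close> the binding vertex of
      \<open>{s, t}\<close>.\<close>
    obtain p where p: "n \<le> p" "p < n1" "{w. adjacent B p w} = {i, j}"
      using binding_vertex_exists ij \<open>i \<noteq> j\<close> by metis
    have pe: "binding_edge n B i p" "binding_edge n B p j"
      using p ij adjacent_sym by (auto simp: binding_edge_def)
    obtain q where q: "q < n1" "{K $$ (i, p), K $$ (p, j)} = {K $$ (s, q), K $$ (q, t)}"
      using square_stable_exchange[OF Kc K(2) b p(2) eq] by blast
    have qe: "binding_edge n B s q" "binding_edge n B q t"
      using q K_binding_edge pe b p(2) by (auto simp: doubleton_eq_iff)
    have qn: "n \<le> q" using qe(1) st by (auto simp: binding_edge_def)
    have Nq: "{w. adjacent B q w} = {s, t}"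
      using binding_neighbours_eqI[OF qn] qe ne adjacent_sym by (auto simp: binding_edge_def)
    \<comment> \<open>The colour of \<open>p\<close> reappears at \<open>s\<close>, \<open>q\<close>
      or \<open>t\<close>, of which only \<open>q\<close> is a binding vertex.\<close>
    have "K $$ (i, p) = K $$ (s, q) \<or> K $$ (i, p) = K $$ (q, t)" using q by auto
    hence "K $$ (p, p) = K $$ (s, s) \<or> K $$ (p, p) = K $$ (q, q) \<or> K $$ (p, p) = K $$ (t, t)"
      using square_stable_ends(2)[OF Kc K(2) sep b(1) p(2)] b q(1) by metis
    hence "K $$ (p, p) = K $$ (q, q)" using K_basic p b st by (metis not_less)
    hence "M $$ (p, p) = M $$ (q, q)"
      using K_diag[OF p(2) q(1)] \<Theta>_diag p q(1) qn by simp
    thus ?thesis using M_binding_diag_adjacent[OF p(2,3) q(1) Nq] adj by blast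
  qed
  have "refines K (S 0)"
  proof (rule refines_diag_substI[OF S_initial B_carrier Kc sep])
    fix i j s t assume b: "i < n1" "j < n1" "s < n1" "t < n1" "i \<noteq> j" "s \<noteq> t"
      and eq: "K $$ (i, j) = K $$ (s, t)"
    \<comment> \<open>Edges of \<open>B\<close> share one label and all other entries are
      \<open>x0\<close>, so adjacency decides the entry.\<close>
    have "adjacent B i j \<longleftrightarrow> adjacent B s t"
      using K_adjacent[OF b(1-4) eq] K_adjacent[OF b(3,4,1,2) eq[symmetric]] by blast
    thus "B $$ (i, j) = B $$ (s, t)"
      using edge_labels_eq[of i j s t] b by (cases "adjacent B i j") (auto simp: adjacent_iff)
  qed (simp add: B_diag)
  hence KM: "refines K M" using M_coarsest K(2) by blast
  show ?thesis
  proof (rule refines_diag_substI[OF \<Phi>1 \<Phi>_carrier Kc sep])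
    fix i j assume b: "i < n1" "j < n1" and "K $$ (i, i) = K $$ (j, j)"
    hence "M $$ (i, i) = M $$ (j, j)" by (intro refinesD[OF KM Kc])
    thus "\<Phi> $$ (i, i) = \<Phi> $$ (j, j)" using \<Phi>_diag b by simp
  next
    fix i j s t assume b: "i < n1" "j < n1" "s < n1" "t < n1" "i \<noteq> j" "s \<noteq> t"
      and eq: "K $$ (i, j) = K $$ (s, t)"
    have "binding_edge n B i j \<longleftrightarrow> binding_edge n B s t"
      using K_binding_edge[OF b(1-4) eq] K_binding_edge[OF b(3,4,1,2) eq[symmetric]] by blast
    thus "\<Phi> $$ (i, j) = \<Phi> $$ (s, t)"
      using refinesD[OF KM Kc b(1-4) eq] \<Phi>_offdiag b by simp
  qed
qed

text \<open>Each limit is finer than the initial graph of the other process, hence than the other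
  limit by maximality. The processes are arbitrary, so the choice of variables does not
  matter.\<close>

lemma first_stable_equiv:
  assumes "refinement_operator F"
    and P: "diag_subst \<Phi> (P 0)" "\<And>i. var_subst (F (P i)) (P (Suc i))"
    and Q: "diag_subst \<Theta> (Q 0)" "\<And>i. var_subst (F (Q i)) (Q (Suc i))"
  shows "first_stable P \<approx>\<^sub>g first_stable Q"
proof -
  interpret refinement_operator F by fact
  have "refines (first_stable P) (Q 0)"
    using first_stable_refines_initial[OF \<Phi>_carrier P] \<Phi>_refines_\<Theta>[OF P(1) Q(1)]
    by (rule refines_trans)
  hence "refines (first_stable P) (first_stable Q)"
    using refines_first_stable[OF \<Theta>_carrier Q] first_stable_stable[OF \<Phi>_carrier P] by blast
  moreover have "refines (first_stable Q) (P 0)"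
    using stable_\<Theta>_refines_\<Phi>[OF P(1) Q(1)] first_stable_refines_initial[OF \<Theta>_carrier Q]
      first_stable_refines_square[OF \<Theta>_carrier Q] by blast
  hence "refines (first_stable Q) (first_stable P)"
    using refines_first_stable[OF \<Phi>_carrier P] first_stable_stable[OF \<Theta>_carrier Q] by blast
  ultimately show ?thesis by (simp add: mat_equiv_iff_refines)
qed

end

end

end

theorem theorem9:
  fixes n n1 :: nat and A B M \<Phi> \<Theta> :: graph and x :: label
  assumes "n > 2"
    and "simple_graph n A" and "connected_graph A"
    and "n1 = n * (n + 1) div 2"
    and "binding_graph n n1 A B"
    and "stable_graph B M"
    and "\<Phi> = mat n1 n1 (\<lambda>(i, j).
           if i \<noteq> j \<and> \<not> binding_edge n B i j then x0 else M $$ (i, j))"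
    and "x \<in> Var" and "x \<notin> elements_mat \<Phi>"
    and "\<Theta> = mat n1 n1 (\<lambda>(i, j).
           if i = j \<and> n \<le> i then \<Phi> $$ (i, i)
           else if binding_edge n B i j then x
           else x0)"
  shows "(\<forall>H K. stable_graph \<Phi> H \<and> stable_graph \<Theta> K \<longrightarrow> H \<approx>\<^sub>g K) \<and>
         (\<forall>H K. WL_graph \<Phi> H \<and> WL_graph \<Theta> K \<longrightarrow> H \<approx>\<^sub>g K)"
proof -
  interpret binding_graph_of n n1 A B by unfold_locales (use assms in auto)
  \<comment> \<open>A process producing \<open>M\<close> is fixed because the argument refers to its
    first graph \<open>S 0\<close>.\<close>
  obtain S where S: "SaS_process B S" "M = first_stable S"
    using assms(6) by (auto simp: stable_graph_def)
  note equiv = first_stable_equiv[OF S assms(7,8,10)]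
  show ?thesis
    unfolding stable_graph_def WL_graph_def SaS_process_def WL_process_def
    using equiv[OF SaS.refinement_operator_axioms] equiv[OF WL.refinement_operator_axioms]
    by blast
qed

end
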